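(* Let $R$ be a commutative ring and $M$ a nonzero totally ordered (commutative) monoid with the cancellation property, written additively. Then the monoid-ring $R[M]$ is quasi-Jacobson, i.e. the nilradical and the Jacobson radical of $R[M]$ are equal.
   Context: Rings have an identity. $R[M]$ is the free $R$-module with basis $\{\epsilon_m: m\in M\}$ and multiplication determined $R$-bilinearly by $\epsilon_m\epsilon_n=\epsilon_{m+n}$. A monoid is nonzero if it has more than one element. A totally ordered monoid is a commutative monoid with a total order $<$ such that $a<b$ implies $a+x\leqslant b+x$ for all $x$; the cancellation property means $a+x=b+x$ implies $a=b$. *)

theory Defs
  imports "HOL-Algebra.Divisibility" "HOL-Algebra.Ideal"
begin

text \<open>
  Monoids are written multiplicatively, following HOL-Algebra: the sum \<open>a + b\<close> of the
  additive notation is \<open>a \<otimes>\<^bsub>M\<^esub> b\<close> and the neutral element is \<open>\<one>\<^bsub>M\<^esub>\<close>.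

  The free \<open>R\<close>-module on the carrier of \<open>M\<close> consists of the finitely supported functions from
  the carrier of \<open>M\<close> to the carrier of \<open>R\<close>, extended by \<open>\<zero>\<^bsub>R\<^esub>\<close> to the rest of the type (so that
  equality of elements is equality of functions).
\<close>

definition monoid_ring :: "('a, 'b) ring_scheme \<Rightarrow> ('m, 'c) monoid_scheme \<Rightarrow> ('m \<Rightarrow> 'a) ring" where
  "monoid_ring R M =
    \<lparr> carrier = {f \<in> carrier M \<rightarrow> carrier R.
                   (\<forall>m. m \<notin> carrier M \<longrightarrow> f m = \<zero>\<^bsub>R\<^esub>) \<and> finite {m. f m \<noteq> \<zero>\<^bsub>R\<^esub>}},
      mult = (\<lambda>f g z. \<Oplus>\<^bsub>R\<^esub>p \<in> {(x, y). f x \<noteq> \<zero>\<^bsub>R\<^esub> \<and> g y \<noteq> \<zero>\<^bsub>R\<^esub> \<and> x \<otimes>\<^bsub>M\<^esub> y = z}.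
                         f (fst p) \<otimes>\<^bsub>R\<^esub> g (snd p)),
      one = (\<lambda>z. if z = \<one>\<^bsub>M\<^esub> then \<one>\<^bsub>R\<^esub> else \<zero>\<^bsub>R\<^esub>),
      zero = (\<lambda>z. \<zero>\<^bsub>R\<^esub>),
      add = (\<lambda>f g z. f z \<oplus>\<^bsub>R\<^esub> g z) \<rparr>"

definition monoid_ring_basis :: "('a, 'b) ring_scheme \<Rightarrow> 'm \<Rightarrow> 'm \<Rightarrow> 'a" where
  "monoid_ring_basis R m = (\<lambda>z. if z = m then \<one>\<^bsub>R\<^esub> else \<zero>\<^bsub>R\<^esub>)"

lemma (in ring) monoid_ring_basis_mult:
  "monoid_ring_basis R m \<otimes>\<^bsub>monoid_ring R M\<^esub> monoid_ring_basis R n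
     = monoid_ring_basis R (m \<otimes>\<^bsub>M\<^esub> n)"
proof (cases "\<one> = \<zero>")
  case True
  then show ?thesis by (simp add: monoid_ring_def monoid_ring_basis_def fun_eq_iff)
next
  case False
  show ?thesis
  proof
    fix z
    have "{(x, y). monoid_ring_basis R m x \<noteq> \<zero> \<and> monoid_ring_basis R n y \<noteq> \<zero> \<and> x \<otimes>\<^bsub>M\<^esub> y = z}
        = (if z = m \<otimes>\<^bsub>M\<^esub> n then {(m, n)} else {})"
      using False by (auto simp: monoid_ring_basis_def split: if_splits)
    then show "(monoid_ring_basis R m \<otimes>\<^bsub>monoid_ring R M\<^esub> monoid_ring_basis R n) z
        = monoid_ring_basis R (m \<otimes>\<^bsub>M\<^esub> n) z"
      by (simp add: monoid_ring_def) (simp add: monoid_ring_basis_def)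
  qed
qed

locale totally_ordered_monoid = comm_monoid M
  for M :: "('m, 'c) monoid_scheme" (structure) +
  fixes less :: "'m \<Rightarrow> 'm \<Rightarrow> bool" (infix \<open>\<sqsubset>\<close> 50)
  assumes less_irrefl: "irreflp_on (carrier M) (\<sqsubset>)"
    and less_trans: "transp_on (carrier M) (\<sqsubset>)"
    and less_total: "totalp_on (carrier M) (\<sqsubset>)"
    and mult_mono: "\<lbrakk>a \<in> carrier M; b \<in> carrier M; x \<in> carrier M; a \<sqsubset> b\<rbrakk>
      \<Longrightarrow> a \<otimes> x \<sqsubset> b \<otimes> x \<or> a \<otimes> x = b \<otimes> x"

definition nilradical :: "('a, 'b) ring_scheme \<Rightarrow> 'a set" where
  "nilradical A = {x \<in> carrier A. \<exists>n::nat. x [^]\<^bsub>A\<^esub> n = \<zero>\<^bsub>A\<^esub>}"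

text \<open>
  The radicals are used for commutative rings only. In the zero ring, which has no maximal
  ideals, the Jacobson radical is the whole ring.
\<close>

definition jacobson_radical :: "('a, 'b) ring_scheme \<Rightarrow> 'a set" where
  "jacobson_radical A = {x \<in> carrier A. \<forall>I. maximalideal I A \<longrightarrow> x \<in> I}"

definition quasi_jacobson :: "('a, 'b) ring_scheme \<Rightarrow> bool" where
  "quasi_jacobson A \<longleftrightarrow> nilradical A = jacobson_radical A"

end

theory Submission
  imports Defs "HOL-Algebra.Ring_Divisibility"
begin

text \<open>
  Let \<open>P\<close> be a prime ideal of \<open>R\<close> and \<open>f g = \<one>\<close> in \<open>R[M]\<close>. Multiplying the extreme terms of \<open>f\<close> and
  \<open>g\<close> modulo \<open>P\<close>, at both ends of the order, shows that \<open>f\<close> has exactly one coefficient outside \<open>P\<close>.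
  Now let \<open>x\<close> lie in the Jacobson radical. The monoid \<open>M\<close> is infinite, so the support of \<open>x\<close> can be
  translated by some \<open>m\<close> away from the neutral element. The unit \<open>\<one> - \<epsilon>\<^sub>m x\<close> has coefficient \<open>\<one>\<close> at the
  neutral element, so all its other coefficients, which are those of \<open>- x\<close>, lie in every prime \<open>P\<close>.
  Hence the coefficients of \<open>x\<close> are nilpotent, and so is \<open>x\<close>.
\<close>

section \<open>Prime and maximal ideals\<close>

text \<open>Zorn's lemma. Two choices of \<open>S\<close> matter: \<open>{\<one>}\<close> produces
  maximal ideals, and the set of powers of an element produces prime ideals.\<close>

lemma (in ring) exists_maximal_ideal_avoiding:
  assumes "ideal I R" and "I \<inter> S = {}"
  obtains J where "ideal J R" "I \<subseteq> J" "J \<inter> S = {}"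
    "\<And>K. \<lbrakk>ideal K R; J \<subseteq> K; K \<inter> S = {}\<rbrakk> \<Longrightarrow> K = J"
proof -
  let ?F = "{J. ideal J R \<and> I \<subseteq> J \<and> J \<inter> S = {}}"
  have "\<exists>J\<in>?F. \<forall>K\<in>?F. J \<subseteq> K \<longrightarrow> K = J"
  proof (rule subset_Zorn_nonempty)
    show "?F \<noteq> {}" using assms by auto
  next
    fix C assume C: "C \<noteq> {}" "subset.chain ?F C"
    then have sub: "C \<subseteq> ?F" by (auto simp: subset.chain_def)
    have "subset.chain {I. ideal I R} C"
      using C by (auto simp: subset.chain_def)
    from chain_Union_is_ideal[OF this] have "ideal (\<Union>C) R"
      using C by simp
    moreover have "I \<subseteq> \<Union>C" "\<Union>C \<inter> S = {}"
      using C(1) sub by blast+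
    ultimately show "\<Union>C \<in> ?F" by simp
  qed
  then obtain J where J: "ideal J R" "I \<subseteq> J" "J \<inter> S = {}"
    and max: "\<And>K. \<lbrakk>ideal K R; I \<subseteq> K; K \<inter> S = {}; J \<subseteq> K\<rbrakk> \<Longrightarrow> K = J"
    by auto
  show thesis
    by (rule that[OF J]) (use max J(2) in blast)
qed

text \<open>The principal ideal of a non-unit misses \<open>\<one>\<close>, and an ideal that is
  maximal among those missing \<open>\<one>\<close> is a maximal ideal.\<close>

lemma (in cring) Units_if_in_no_maximalideal:
  assumes a: "a \<in> carrier R" and "\<And>I. maximalideal I R \<Longrightarrow> a \<notin> I"
  shows "a \<in> Units R"
proof (rule ccontr)
  assume nu: "a \<notin> Units R"
  have "\<one> \<notin> PIdl a"
    using nu a m_comm unfolding cgenideal_def Units_def by fastforce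
  then have "PIdl a \<inter> {\<one>} = {}" by simp
  then obtain J where J: "ideal J R" "PIdl a \<subseteq> J" "J \<inter> {\<one>} = {}"
    "\<And>K. \<lbrakk>ideal K R; J \<subseteq> K; K \<inter> {\<one>} = {}\<rbrakk> \<Longrightarrow> K = J"
    using exists_maximal_ideal_avoiding[OF cgenideal_ideal[OF a]] by metis
  have "maximalideal J R"
  proof (rule maximalidealI)
    show "carrier R \<noteq> J" using J(3) by auto
    fix K assume "ideal K R" "J \<subseteq> K"
    then show "K = J \<or> K = carrier R"
      using J(4)[of K] ideal.one_imp_carrier[of K R] by blast
  qed (fact J)
  moreover have "a \<in> J" using J(2) cgenideal_self[OF a] by blast
  ultimately show False using assms(2) by blast
qed

text \<open>Krull's argument: if no power of \<open>c\<close> vanishes, an ideal \<open>J\<close>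
  that is maximal among those disjoint from the powers of \<open>c\<close> is prime, and it does not
  contain \<open>c\<close>.\<close>

lemma (in cring) nilpotent_if_in_all_primeideals:
  assumes c: "c \<in> carrier R" and all: "\<And>P. primeideal P R \<Longrightarrow> c \<in> P"
  shows "\<exists>n::nat. c [^] n = \<zero>"
proof (rule ccontr)
  assume neg: "\<nexists>n::nat. c [^] n = \<zero>"
  define S where "S = range (\<lambda>n::nat. c [^] n)"
  have Smult: "s \<otimes> t \<in> S" if "s \<in> S" "t \<in> S" for s t
    using that c by (auto simp: S_def nat_pow_mult)
  have cS: "c \<in> S" and oneS: "\<one> \<in> S"
    using c nat_pow_eone[OF c] by (auto simp: S_def image_iff intro: exI[of _ "1::nat"] exI[of _ "0::nat"])
  have "{\<zero>} \<inter> S = {}" using neg by (auto simp: S_def)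
  from exists_maximal_ideal_avoiding[OF zeroideal this]
  obtain J where J: "ideal J R" "J \<inter> S = {}"
    and max: "\<And>K. \<lbrakk>ideal K R; J \<subseteq> K; K \<inter> S = {}\<rbrakk> \<Longrightarrow> K = J"
    by metis
  interpret J: ideal J R by fact
  \<comment> \<open>The ideal generated by \<open>J\<close> and \<open>a\<close> is strictly larger
    than \<open>J\<close>, so by maximality it meets \<open>S\<close>.\<close>
  have meets: "\<exists>j\<in>J. \<exists>r\<in>carrier R. j \<oplus> r \<otimes> a \<in> S" if a: "a \<in> carrier R" "a \<notin> J" for a
  proof -
    let ?K = "J <+>\<^bsub>R\<^esub> PIdl a"
    have K: "ideal ?K R" by (rule add_ideals[OF J(1) cgenideal_ideal[OF a(1)]])
    have "j \<in> ?K" if "j \<in> J" for j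
    proof -
      have "\<zero> \<in> PIdl a"
        using additive_subgroup.zero_closed[OF ideal.axioms(1)[OF cgenideal_ideal[OF a(1)]]] .
      then have "j \<oplus> \<zero> \<in> ?K" using that unfolding set_add_def' by blast
      then show ?thesis using that by simp
    qed
    moreover have "\<zero> \<oplus> a \<in> ?K"
      using J.zero_closed cgenideal_self[OF a(1)] unfolding set_add_def' by blast
    ultimately have "?K \<inter> S \<noteq> {}" using max[OF K] a by auto
    then show ?thesis unfolding set_add_def' cgenideal_def by blast
  qed
  have "primeideal J R"
  proof (rule primeidealI[OF J(1) is_cring])
    show "carrier R \<noteq> J" using J(2) oneS by auto
    fix a b assume ab: "a \<in> carrier R" "b \<in> carrier R" "a \<otimes> b \<in> J"
    show "a \<in> J \<or> b \<in> J"
    proof (rule ccontr)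
      assume "\<not> (a \<in> J \<or> b \<in> J)"
      then obtain j r k q where jr: "j \<in> J" "r \<in> carrier R" "j \<oplus> r \<otimes> a \<in> S"
        and kq: "k \<in> J" "q \<in> carrier R" "k \<oplus> q \<otimes> b \<in> S"
        using meets ab by metis
      have [simp]: "j \<in> carrier R" "k \<in> carrier R" using jr kq by auto
      \<comment> \<open>The product of two elements of \<open>S\<close> is again in
        \<open>S\<close>, yet each term of its expansion has a factor \<open>j\<close>,
        \<open>k\<close> or \<open>a \<otimes> b\<close> in \<open>J\<close>.\<close>
      have "(j \<oplus> r \<otimes> a) \<otimes> (k \<oplus> q \<otimes> b)
          = j \<otimes> (k \<oplus> q \<otimes> b) \<oplus> (r \<otimes> a \<otimes> k \<oplus> r \<otimes> q \<otimes> (a \<otimes> b))"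
        using ab jr(2) kq(2) by (simp add: l_distr r_distr m_ac a_ac)
      also have "\<dots> \<in> J"
        using ab jr(1,2) kq(1,2) by (simp add: J.I_l_closed J.I_r_closed)
      finally show False using Smult[OF jr(3) kq(3)] J(2) by blast
    qed
  qed
  then show False using all cS J(2) by blast
qed

lemma (in primeideal) mem_if_pow_mem:
  assumes "x \<in> carrier R" and "x [^] (n::nat) \<in> I"
  shows "x \<in> I"
  using assms(2)
proof (induction n)
  \<comment> \<open>Vacuous: \<open>x [^] 0\<close> is \<open>\<one>\<close>, which no proper ideal
    contains.\<close>
  case 0
  then show ?case using one_imp_carrier I_notcarr by auto
next
  case (Suc n)
  then show ?case using I_prime[of "x [^] n" x] assms(1) by auto
qed

lemma (in cring) nilradical_subset_primeideal:
  assumes "primeideal P R" shows "nilradical R \<subseteq> P"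
proof
  interpret P: primeideal P R by fact
  fix x assume "x \<in> nilradical R"
  then obtain n :: nat where "x \<in> carrier R" "x [^] n = \<zero>" by (auto simp: nilradical_def)
  then show "x \<in> P" using P.mem_if_pow_mem[of x n] P.zero_closed by simp
qed

text \<open>With this description, nilpotency of a sum can be checked in one prime ideal at a time,
  without bounding exponents.\<close>

lemma (in cring) nilradical_eq_Inter:
  "nilradical R = {x \<in> carrier R. \<forall>P. primeideal P R \<longrightarrow> x \<in> P}"
  using nilradical_subset_primeideal nilpotent_if_in_all_primeideals
  by (auto simp: nilradical_def)

lemma (in cring) nilradical_subset_jacobson_radical: "nilradical R \<subseteq> jacobson_radical R"
  using maximalideal_prime by (auto simp: nilradical_eq_Inter jacobson_radical_def)

text \<open>For infinite \<open>A\<close> the sum is zero by convention, and zero lies in the ideal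
  as well.\<close>

lemma (in ideal) finsum_mem:
  assumes "\<And>x. x \<in> A \<Longrightarrow> f x \<in> I"
  shows "(\<Oplus>x\<in>A. f x) \<in> I"
  using assms
proof (induction A rule: infinite_finite_induct)
  case (insert x A)
  then have "f \<in> insert x A \<rightarrow> carrier R" by auto
  then show ?case using insert by (simp add: Pi_def)
qed simp_all

section \<open>Iterated finite sums\<close>

context abelian_monoid
begin

lemma finsum_swap:
  assumes "\<And>x y. \<lbrakk>x \<in> A; y \<in> B\<rbrakk> \<Longrightarrow> f x y \<in> carrier G"
  shows "(\<Oplus>x\<in>A. \<Oplus>y\<in>B. f x y) = (\<Oplus>y\<in>B. \<Oplus>x\<in>A. f x y)"
  using assms
proof (induction A rule: infinite_finite_induct)
  case (insert a A)
  have "(\<Oplus>x\<in>insert a A. \<Oplus>y\<in>B. f x y) = (\<Oplus>y\<in>B. f a y) \<oplus> (\<Oplus>y\<in>B. \<Oplus>x\<in>A. f x y)"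
    using insert by (simp add: Pi_def)
  also have "\<dots> = (\<Oplus>y\<in>B. f a y \<oplus> (\<Oplus>x\<in>A. f x y))"
    using insert.prems by (intro finsum_addf[symmetric]) (auto simp: Pi_def intro!: finsum_closed)
  also have "\<dots> = (\<Oplus>y\<in>B. \<Oplus>x\<in>insert a A. f x y)"
    using insert by (intro finsum_cong' refl) (auto simp: Pi_def intro!: finsum_closed)
  finally show ?case .
qed simp_all

lemma finsum_Times:
  assumes "finite A" "finite B" "\<And>x y. \<lbrakk>x \<in> A; y \<in> B\<rbrakk> \<Longrightarrow> f (x, y) \<in> carrier G"
  shows "(\<Oplus>p\<in>A \<times> B. f p) = (\<Oplus>x\<in>A. \<Oplus>y\<in>B. f (x, y))"
  using assms(1,3)
proof (induction A)
  case (insert a A)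
  have "(\<Oplus>p\<in>Pair a ` B \<union> A \<times> B. f p) = (\<Oplus>p\<in>Pair a ` B. f p) \<oplus> (\<Oplus>p\<in>A \<times> B. f p)"
    using insert assms(2) by (intro finsum_Un_disjoint) auto
  also have "(\<Oplus>p\<in>Pair a ` B. f p) = (\<Oplus>y\<in>B. f (a, y))"
    using insert.prems by (intro finsum_reindex) (auto simp: inj_on_def)
  also have "Pair a ` B \<union> A \<times> B = insert a A \<times> B" by auto
  finally show ?case using insert by (simp add: Pi_def)
qed simp

end

section \<open>The monoid ring\<close>

locale cring_comm_monoid = cring R + M: comm_monoid M
  for R :: "('a, 'b) ring_scheme" (structure) and M :: "('m, 'c) monoid_scheme"
begin

section \<open>Supports and the convolution product\<close>

abbreviation RM :: "('m \<Rightarrow> 'a) ring" where "RM \<equiv> monoid_ring R M"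

definition supp :: "('m \<Rightarrow> 'a) \<Rightarrow> 'm set" where "supp f = {m. f m \<noteq> \<zero>}"

text \<open>This is \<open>c\<close> times the basis element at \<open>m\<close>; in particular
  \<open>monom \<one> m\<close> is \<open>monoid_ring_basis R m\<close>.\<close>

definition monom :: "'a \<Rightarrow> 'm \<Rightarrow> 'm \<Rightarrow> 'a" where "monom c m = (\<lambda>z. if z = m then c else \<zero>)"

lemma monoid_ring_simps:
  "\<one>\<^bsub>RM\<^esub> = monom \<one> \<one>\<^bsub>M\<^esub>" "\<zero>\<^bsub>RM\<^esub> = (\<lambda>z. \<zero>)" "(f \<oplus>\<^bsub>RM\<^esub> g) z = f z \<oplus> g z"
  by (auto simp: monoid_ring_def monom_def)

lemma mem_carrier_iff:
  "f \<in> carrier RM \<longleftrightarrow> (\<forall>m. f m \<in> carrier R) \<and> supp f \<subseteq> carrier M \<and> finite (supp f)"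
proof
  assume "f \<in> carrier RM"
  then have f: "\<And>m. m \<in> carrier M \<Longrightarrow> f m \<in> carrier R" "\<And>m. m \<notin> carrier M \<Longrightarrow> f m = \<zero>"
    "finite (supp f)"
    by (auto simp: monoid_ring_def supp_def)
  have "f m \<in> carrier R" for m using f(1,2)[of m] by (cases "m \<in> carrier M") auto
  then show "(\<forall>m. f m \<in> carrier R) \<and> supp f \<subseteq> carrier M \<and> finite (supp f)"
    using f by (auto simp: supp_def)
qed (auto simp: monoid_ring_def supp_def)

lemma mem_carrierI:
  assumes "\<And>m. f m \<in> carrier R" "supp f \<subseteq> X" "finite X" "X \<subseteq> carrier M"
  shows "f \<in> carrier RM"
  unfolding mem_carrier_iff using assms(1) subset_trans[OF assms(2,4)] finite_subset[OF assms(2,3)]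
  by blast

lemma
  assumes "f \<in> carrier RM"
  shows coeff_closed [simp]: "f m \<in> carrier R"
    and supp_carrier: "supp f \<subseteq> carrier M"
    and finite_supp [simp]: "finite (supp f)"
  using assms by (auto simp: mem_carrier_iff)

lemma coeff_eq_zero: "supp f \<subseteq> X \<Longrightarrow> x \<notin> X \<Longrightarrow> f x = \<zero>"
  by (auto simp: supp_def)

lemma finite_mult_support:
  assumes "f \<in> carrier RM" "g \<in> carrier RM"
  shows "finite {(x, y). f x \<noteq> \<zero> \<and> g y \<noteq> \<zero> \<and> x \<otimes>\<^bsub>M\<^esub> y = z}"
proof (rule finite_subset)
  show "{(x, y). f x \<noteq> \<zero> \<and> g y \<noteq> \<zero> \<and> x \<otimes>\<^bsub>M\<^esub> y = z} \<subseteq> supp f \<times> supp g"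
    by (auto simp: supp_def)
qed (use assms in simp)

text \<open>Moving the condition on \<open>x\<close> and \<open>y\<close> into the summand makes the
  index set a rectangle, so the order of summation can be exchanged. Allowing any finite
  \<open>X\<close> and \<open>Y\<close> above the supports lets several elements share one index
  set.\<close>

lemma mult_coeff:
  assumes f: "f \<in> carrier RM" "supp f \<subseteq> X" "finite X"
    and g: "g \<in> carrier RM" "supp g \<subseteq> Y" "finite Y"
  shows "(f \<otimes>\<^bsub>RM\<^esub> g) z = (\<Oplus>x\<in>X. \<Oplus>y\<in>Y. if x \<otimes>\<^bsub>M\<^esub> y = z then f x \<otimes> g y else \<zero>)"
proof -
  have "(f \<otimes>\<^bsub>RM\<^esub> g) z =
      (\<Oplus>p\<in>X \<times> Y. if fst p \<otimes>\<^bsub>M\<^esub> snd p = z then f (fst p) \<otimes> g (snd p) else \<zero>)"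
    unfolding monoid_ring_def monoid.simps
    using f g by (intro add.finprod_mono_neutral_cong_left) (auto simp: supp_def)
  also have "\<dots> = (\<Oplus>x\<in>X. \<Oplus>y\<in>Y. if x \<otimes>\<^bsub>M\<^esub> y = z then f x \<otimes> g y else \<zero>)"
    using f g by (subst finsum_Times) (auto cong: if_cong)
  finally show ?thesis .
qed

lemma supp_mult:
  assumes f: "f \<in> carrier RM" and g: "g \<in> carrier RM"
  shows "supp (f \<otimes>\<^bsub>RM\<^esub> g) \<subseteq> (\<lambda>(x, y). x \<otimes>\<^bsub>M\<^esub> y) ` (supp f \<times> supp g)"
proof
  fix z assume z: "z \<in> supp (f \<otimes>\<^bsub>RM\<^esub> g)"
  show "z \<in> (\<lambda>(x, y). x \<otimes>\<^bsub>M\<^esub> y) ` (supp f \<times> supp g)"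
  proof (rule ccontr)
    assume "z \<notin> (\<lambda>(x, y). x \<otimes>\<^bsub>M\<^esub> y) ` (supp f \<times> supp g)"
    then have "{(x, y). f x \<noteq> \<zero> \<and> g y \<noteq> \<zero> \<and> x \<otimes>\<^bsub>M\<^esub> y = z} = {}"
      by (auto simp: supp_def)
    then have "(f \<otimes>\<^bsub>RM\<^esub> g) z = \<zero>"
      unfolding monoid_ring_def monoid.simps by (simp only: finsum_empty)
    then show False using z by (simp add: supp_def)
  qed
qed

lemma mult_closed:
  assumes f: "f \<in> carrier RM" and g: "g \<in> carrier RM"
  shows "f \<otimes>\<^bsub>RM\<^esub> g \<in> carrier RM"
proof (rule mem_carrierI[OF _ supp_mult[OF f g]])
  show "(f \<otimes>\<^bsub>RM\<^esub> g) z \<in> carrier R" for z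
    using f g by (subst mult_coeff[OF f subset_refl _ g subset_refl]) (auto intro!: finsum_closed)
  show "(\<lambda>(x, y). x \<otimes>\<^bsub>M\<^esub> y) ` (supp f \<times> supp g) \<subseteq> carrier M"
    using supp_carrier[OF f] supp_carrier[OF g] by fastforce
qed (use f g in simp)

lemma mult_comm:
  assumes f: "f \<in> carrier RM" and g: "g \<in> carrier RM"
  shows "f \<otimes>\<^bsub>RM\<^esub> g = g \<otimes>\<^bsub>RM\<^esub> f"
proof
  fix z
  have "(f \<otimes>\<^bsub>RM\<^esub> g) z =
      (\<Oplus>x\<in>supp f. \<Oplus>y\<in>supp g. if x \<otimes>\<^bsub>M\<^esub> y = z then f x \<otimes> g y else \<zero>)"
    using f g by (intro mult_coeff) auto
  also have "\<dots> = (\<Oplus>y\<in>supp g. \<Oplus>x\<in>supp f. if x \<otimes>\<^bsub>M\<^esub> y = z then f x \<otimes> g y else \<zero>)"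
    using f g by (intro finsum_swap) auto
  also have "\<dots> = (\<Oplus>y\<in>supp g. \<Oplus>x\<in>supp f. if y \<otimes>\<^bsub>M\<^esub> x = z then g y \<otimes> f x else \<zero>)"
    using f g supp_carrier[OF f] supp_carrier[OF g]
    by (intro finsum_cong' refl) (auto simp: m_comm M.m_comm subset_iff intro!: finsum_closed)
  also have "\<dots> = (g \<otimes>\<^bsub>RM\<^esub> f) z"
    using f g by (intro mult_coeff[symmetric]) auto
  finally show "(f \<otimes>\<^bsub>RM\<^esub> g) z = (g \<otimes>\<^bsub>RM\<^esub> f) z" .
qed

text \<open>
  Pairing with a test function \<open>\<phi>\<close> turns the convolution into an iterated sum.
  With \<open>\<phi>\<close> built from a third factor this expands triple products symmetrically, so associativity
  follows from commutativity.
\<close>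

lemma mult_pairing:
  assumes f: "f \<in> carrier RM" and g: "g \<in> carrier RM" and phi: "\<And>m. \<phi> m \<in> carrier R"
  shows "(\<Oplus>u\<in>supp (f \<otimes>\<^bsub>RM\<^esub> g). (f \<otimes>\<^bsub>RM\<^esub> g) u \<otimes> \<phi> u) =
    (\<Oplus>x\<in>supp f. \<Oplus>y\<in>supp g. f x \<otimes> g y \<otimes> \<phi> (x \<otimes>\<^bsub>M\<^esub> y))"
proof -
  let ?U = "(\<lambda>(x, y). x \<otimes>\<^bsub>M\<^esub> y) ` (supp f \<times> supp g)"
  let ?X = "supp f" and ?Y = "supp g"
  let ?t = "\<lambda>x y u. if x \<otimes>\<^bsub>M\<^esub> y = u then f x \<otimes> g y \<otimes> \<phi> u else \<zero>"
  note fg = mult_closed[OF f g]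
  have fin: "finite ?U" using f g by simp
  have cl [simp]: "f x \<in> carrier R" "g x \<in> carrier R" "\<phi> x \<in> carrier R" for x
    using f g phi by auto
  \<comment> \<open>Cancellation can make the support of the product smaller than \<open>?U\<close>;
    the additional terms are zero.\<close>
  have "(\<Oplus>u\<in>supp (f \<otimes>\<^bsub>RM\<^esub> g). (f \<otimes>\<^bsub>RM\<^esub> g) u \<otimes> \<phi> u) = (\<Oplus>u\<in>?U. (f \<otimes>\<^bsub>RM\<^esub> g) u \<otimes> \<phi> u)"
    using fin supp_mult[OF f g] fg by (intro add.finprod_mono_neutral_cong_left) (auto simp: supp_def)
  also have "\<dots> = (\<Oplus>u\<in>?U. \<Oplus>x\<in>?X. \<Oplus>y\<in>?Y. ?t x y u)"
  proof (intro finsum_cong' refl)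
    fix u
    have "(f \<otimes>\<^bsub>RM\<^esub> g) u \<otimes> \<phi> u =
        (\<Oplus>x\<in>?X. \<Oplus>y\<in>?Y. if x \<otimes>\<^bsub>M\<^esub> y = u then f x \<otimes> g y else \<zero>) \<otimes> \<phi> u"
      using f g by (subst mult_coeff[OF f subset_refl _ g subset_refl]) auto
    also have "\<dots> = (\<Oplus>x\<in>?X. (\<Oplus>y\<in>?Y. if x \<otimes>\<^bsub>M\<^esub> y = u then f x \<otimes> g y else \<zero>) \<otimes> \<phi> u)"
      using f by (intro finsum_ldistr) (auto intro!: finsum_closed)
    also have "\<dots> = (\<Oplus>x\<in>?X. \<Oplus>y\<in>?Y. (if x \<otimes>\<^bsub>M\<^esub> y = u then f x \<otimes> g y else \<zero>) \<otimes> \<phi> u)"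
      using g by (intro finsum_cong' refl finsum_ldistr) (auto intro!: finsum_closed)
    also have "\<dots> = (\<Oplus>x\<in>?X. \<Oplus>y\<in>?Y. ?t x y u)"
      by (intro finsum_cong' refl) (auto intro!: finsum_closed)
    finally show "(f \<otimes>\<^bsub>RM\<^esub> g) u \<otimes> \<phi> u = (\<Oplus>x\<in>?X. \<Oplus>y\<in>?Y. ?t x y u)" .
  qed (auto intro!: finsum_closed)
  also have "\<dots> = (\<Oplus>x\<in>?X. \<Oplus>u\<in>?U. \<Oplus>y\<in>?Y. ?t x y u)"
    by (intro finsum_swap) (auto intro!: finsum_closed)
  also have "\<dots> = (\<Oplus>x\<in>?X. \<Oplus>y\<in>?Y. \<Oplus>u\<in>?U. ?t x y u)"
    by (intro finsum_cong' refl finsum_swap) (auto intro!: finsum_closed)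
  also have "\<dots> = (\<Oplus>x\<in>?X. \<Oplus>y\<in>?Y. f x \<otimes> g y \<otimes> \<phi> (x \<otimes>\<^bsub>M\<^esub> y))"
    using fin by (intro finsum_cong' refl finsum_singleton) (auto intro!: finsum_closed)
  finally show ?thesis .
qed

lemma mult_mult_coeff:
  assumes f: "f \<in> carrier RM" and g: "g \<in> carrier RM" and h: "h \<in> carrier RM"
  shows "(f \<otimes>\<^bsub>RM\<^esub> g \<otimes>\<^bsub>RM\<^esub> h) z = (\<Oplus>x\<in>supp f. \<Oplus>y\<in>supp g. \<Oplus>w\<in>supp h.
    if x \<otimes>\<^bsub>M\<^esub> y \<otimes>\<^bsub>M\<^esub> w = z then f x \<otimes> g y \<otimes> h w else \<zero>)"
proof -
  \<comment> \<open>Pairing an element with this test function gives the coefficient at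
    \<open>z\<close> of its product with \<open>h\<close>.\<close>
  let ?phi = "\<lambda>u. \<Oplus>w\<in>supp h. if u \<otimes>\<^bsub>M\<^esub> w = z then h w else \<zero>"
  note fg = mult_closed[OF f g]
  have cl [simp]: "f x \<in> carrier R" "g x \<in> carrier R" "h x \<in> carrier R"
      "(f \<otimes>\<^bsub>RM\<^esub> g) x \<in> carrier R" "?phi x \<in> carrier R" for x
    using f g h fg by (auto intro!: finsum_closed)
  have distr: "c \<otimes> ?phi u = (\<Oplus>w\<in>supp h. if u \<otimes>\<^bsub>M\<^esub> w = z then c \<otimes> h w else \<zero>)"
    if "c \<in> carrier R" for c u
  proof -
    have "c \<otimes> ?phi u = (\<Oplus>w\<in>supp h. c \<otimes> (if u \<otimes>\<^bsub>M\<^esub> w = z then h w else \<zero>))"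
      using h that by (intro finsum_rdistr) auto
    also have "\<dots> = (\<Oplus>w\<in>supp h. if u \<otimes>\<^bsub>M\<^esub> w = z then c \<otimes> h w else \<zero>)"
      using that by (intro finsum_cong' refl) auto
    finally show ?thesis .
  qed
  have "(f \<otimes>\<^bsub>RM\<^esub> g \<otimes>\<^bsub>RM\<^esub> h) z = (\<Oplus>u\<in>supp (f \<otimes>\<^bsub>RM\<^esub> g). (f \<otimes>\<^bsub>RM\<^esub> g) u \<otimes> ?phi u)"
    using fg h by (subst mult_coeff[OF fg subset_refl _ h subset_refl]) (auto simp: distr)
  also have "\<dots> = (\<Oplus>x\<in>supp f. \<Oplus>y\<in>supp g. f x \<otimes> g y \<otimes> ?phi (x \<otimes>\<^bsub>M\<^esub> y))"
    by (rule mult_pairing[OF f g]) simp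
  finally show ?thesis by (simp add: distr)
qed

text \<open>By commutativity the right-bracketed product is a left-bracketed one with the factors
  cyclically permuted, so both sides have the triple expansion above. Only the order of summation
  differs.\<close>

lemma mult_assoc:
  assumes f: "f \<in> carrier RM" and g: "g \<in> carrier RM" and h: "h \<in> carrier RM"
  shows "f \<otimes>\<^bsub>RM\<^esub> g \<otimes>\<^bsub>RM\<^esub> h = f \<otimes>\<^bsub>RM\<^esub> (g \<otimes>\<^bsub>RM\<^esub> h)"
proof
  fix z
  let ?t = "\<lambda>x y w. if x \<otimes>\<^bsub>M\<^esub> y \<otimes>\<^bsub>M\<^esub> w = z then f x \<otimes> g y \<otimes> h w else \<zero>"
  have cl [simp]: "f x \<in> carrier R" "g x \<in> carrier R" "h x \<in> carrier R" for x
    using f g h by auto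
  have "(f \<otimes>\<^bsub>RM\<^esub> (g \<otimes>\<^bsub>RM\<^esub> h)) z = (g \<otimes>\<^bsub>RM\<^esub> h \<otimes>\<^bsub>RM\<^esub> f) z"
    by (simp add: mult_comm[OF f mult_closed[OF g h]])
  also have "\<dots> = (\<Oplus>y\<in>supp g. \<Oplus>w\<in>supp h. \<Oplus>x\<in>supp f.
      if y \<otimes>\<^bsub>M\<^esub> w \<otimes>\<^bsub>M\<^esub> x = z then g y \<otimes> h w \<otimes> f x else \<zero>)"
    by (rule mult_mult_coeff[OF g h f])
  also have "\<dots> = (\<Oplus>y\<in>supp g. \<Oplus>w\<in>supp h. \<Oplus>x\<in>supp f. ?t x y w)"
  proof (intro finsum_cong' refl)
    fix x y w assume "x \<in> supp f" "y \<in> supp g" "w \<in> supp h"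
    then have "x \<in> carrier M" "y \<in> carrier M" "w \<in> carrier M"
      using supp_carrier f g h by blast+
    then have "y \<otimes>\<^bsub>M\<^esub> w \<otimes>\<^bsub>M\<^esub> x = x \<otimes>\<^bsub>M\<^esub> y \<otimes>\<^bsub>M\<^esub> w"
      by (simp add: M.m_ac)
    then show "(if y \<otimes>\<^bsub>M\<^esub> w \<otimes>\<^bsub>M\<^esub> x = z then g y \<otimes> h w \<otimes> f x else \<zero>) = ?t x y w"
      by (simp add: m_ac)
  qed (auto intro!: finsum_closed)
  also have "\<dots> = (\<Oplus>y\<in>supp g. \<Oplus>x\<in>supp f. \<Oplus>w\<in>supp h. ?t x y w)"
    by (intro finsum_cong' refl finsum_swap) (auto intro!: finsum_closed)
  also have "\<dots> = (\<Oplus>x\<in>supp f. \<Oplus>y\<in>supp g. \<Oplus>w\<in>supp h. ?t x y w)"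
    by (intro finsum_swap) (auto intro!: finsum_closed)
  also have "\<dots> = (f \<otimes>\<^bsub>RM\<^esub> g \<otimes>\<^bsub>RM\<^esub> h) z"
    by (rule mult_mult_coeff[OF f g h, symmetric])
  finally show "(f \<otimes>\<^bsub>RM\<^esub> g \<otimes>\<^bsub>RM\<^esub> h) z = (f \<otimes>\<^bsub>RM\<^esub> (g \<otimes>\<^bsub>RM\<^esub> h)) z" ..
qed

section \<open>Monomials\<close>

lemma supp_monom: "supp (monom c m) \<subseteq> {m}"
  by (auto simp: supp_def monom_def)

lemma monom_closed: "c \<in> carrier R \<Longrightarrow> m \<in> carrier M \<Longrightarrow> monom c m \<in> carrier RM"
  by (rule mem_carrierI[OF _ supp_monom]) (simp_all add: monom_def)

lemma monom_mult_coeff: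
  assumes c: "c \<in> carrier R" "m \<in> carrier M" and f: "f \<in> carrier RM" "supp f \<subseteq> Y" "finite Y"
  shows "(monom c m \<otimes>\<^bsub>RM\<^esub> f) z = (\<Oplus>y\<in>Y. if m \<otimes>\<^bsub>M\<^esub> y = z then c \<otimes> f y else \<zero>)"
proof -
  let ?s = "\<lambda>x. \<Oplus>y\<in>Y. if x \<otimes>\<^bsub>M\<^esub> y = z then monom c m x \<otimes> f y else \<zero>"
  have cl: "monom c m x \<in> carrier R" "f y \<in> carrier R" for x y
    using c f by (auto simp: monom_def)
  have s: "?s x \<in> carrier R" for x
    using cl by (intro finsum_closed) auto
  have "(monom c m \<otimes>\<^bsub>RM\<^esub> f) z = (\<Oplus>x\<in>{m}. ?s x)"
    by (rule mult_coeff[OF monom_closed[OF c] supp_monom _ f]) simp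
  also have "\<dots> = ?s m"
    using s finsum_insert[of "{}" m ?s] by simp
  also have "\<dots> = (\<Oplus>y\<in>Y. if m \<otimes>\<^bsub>M\<^esub> y = z then c \<otimes> f y else \<zero>)"
    by (simp add: monom_def cong: if_cong)
  finally show ?thesis .
qed

lemma monom_mult_coeff_translate:
  assumes c: "c \<in> carrier R" "m \<in> carrier M" and f: "f \<in> carrier RM" and s: "s \<in> carrier M"
    and cancel: "\<And>y. \<lbrakk>y \<in> carrier M; m \<otimes>\<^bsub>M\<^esub> y = m \<otimes>\<^bsub>M\<^esub> s\<rbrakk> \<Longrightarrow> y = s"
  shows "(monom c m \<otimes>\<^bsub>RM\<^esub> f) (m \<otimes>\<^bsub>M\<^esub> s) = c \<otimes> f s"
proof -
  \<comment> \<open>Inserting \<open>s\<close> keeps it among the indices even when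
    \<open>f s\<close> is zero.\<close>
  let ?Y = "insert s (supp f)"
  have "(monom c m \<otimes>\<^bsub>RM\<^esub> f) (m \<otimes>\<^bsub>M\<^esub> s)
      = (\<Oplus>y\<in>?Y. if m \<otimes>\<^bsub>M\<^esub> y = m \<otimes>\<^bsub>M\<^esub> s then c \<otimes> f y else \<zero>)"
    using c f by (intro monom_mult_coeff) auto
  also have "\<dots> = (\<Oplus>y\<in>?Y. if s = y then c \<otimes> f y else \<zero>)"
    using c f s cancel supp_carrier[OF f] by (intro finsum_cong' refl) auto
  also have "\<dots> = c \<otimes> f s"
    using c f by (intro finsum_singleton) auto
  finally show ?thesis .
qed

lemma monom_mult_coeff_zero:
  assumes c: "c \<in> carrier R" "m \<in> carrier M" and f: "f \<in> carrier RM"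
    and z: "\<And>s. s \<in> supp f \<Longrightarrow> m \<otimes>\<^bsub>M\<^esub> s \<noteq> z"
  shows "(monom c m \<otimes>\<^bsub>RM\<^esub> f) z = \<zero>"
  using c f z by (subst monom_mult_coeff[OF c f subset_refl]) (auto intro!: add.finprod_one_eqI)

lemma monom_mult_monom:
  assumes "c \<in> carrier R" "d \<in> carrier R" "m \<in> carrier M" "n \<in> carrier M"
  shows "monom c m \<otimes>\<^bsub>RM\<^esub> monom d n = monom (c \<otimes> d) (m \<otimes>\<^bsub>M\<^esub> n)"
  using assms by (intro ext, subst monom_mult_coeff[OF _ _ monom_closed supp_monom])
    (auto simp: monom_def)

section \<open>The ring axioms\<close>

lemma cring_monoid_ring: "cring RM"
proof (rule cringI)
  show "abelian_group RM"
  proof (rule abelian_groupI)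
    fix f g assume f: "f \<in> carrier RM" and g: "g \<in> carrier RM"
    show "f \<oplus>\<^bsub>RM\<^esub> g \<in> carrier RM"
    proof (rule mem_carrierI)
      show "supp (f \<oplus>\<^bsub>RM\<^esub> g) \<subseteq> supp f \<union> supp g"
        by (auto simp: supp_def monoid_ring_simps)
    qed (use f g supp_carrier in \<open>simp_all add: monoid_ring_simps\<close>)
    show "f \<oplus>\<^bsub>RM\<^esub> g = g \<oplus>\<^bsub>RM\<^esub> f"
      using f g by (simp add: fun_eq_iff monoid_ring_simps a_comm)
  next
    show "\<zero>\<^bsub>RM\<^esub> \<in> carrier RM"
      by (rule mem_carrierI[where X = "{}"]) (simp_all add: monoid_ring_simps supp_def)
  next
    fix f assume f: "f \<in> carrier RM"
    show "\<zero>\<^bsub>RM\<^esub> \<oplus>\<^bsub>RM\<^esub> f = f"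
      using f by (simp add: fun_eq_iff monoid_ring_simps)
    let ?g = "\<lambda>z. \<ominus> f z"
    have "?g \<in> carrier RM"
    proof (rule mem_carrierI)
      show "supp ?g \<subseteq> supp f" by (auto simp: supp_def)
    qed (use f supp_carrier in simp_all)
    moreover have "?g \<oplus>\<^bsub>RM\<^esub> f = \<zero>\<^bsub>RM\<^esub>"
      using f by (simp add: fun_eq_iff monoid_ring_simps l_neg)
    ultimately show "\<exists>g\<in>carrier RM. g \<oplus>\<^bsub>RM\<^esub> f = \<zero>\<^bsub>RM\<^esub>" by blast
  qed (simp add: fun_eq_iff monoid_ring_simps a_assoc)
  show "Group.comm_monoid RM"
  proof (rule comm_monoidI)
    show "\<one>\<^bsub>RM\<^esub> \<in> carrier RM" by (simp add: monoid_ring_simps monom_closed)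
  next
    fix f assume f: "f \<in> carrier RM"
    show "\<one>\<^bsub>RM\<^esub> \<otimes>\<^bsub>RM\<^esub> f = f"
    proof
      fix z
      show "(\<one>\<^bsub>RM\<^esub> \<otimes>\<^bsub>RM\<^esub> f) z = f z"
      \<comment> \<open>Elements are functions on the whole type, so points outside the monoid must
        be compared too; both sides vanish there.\<close>
      proof (cases "z \<in> carrier M")
        case True
        then show ?thesis
          using f monom_mult_coeff_translate[of \<one> "\<one>\<^bsub>M\<^esub>" f z] by (simp add: monoid_ring_simps)
      next
        case False
        then have "f z = \<zero>" using coeff_eq_zero[OF supp_carrier[OF f]] by simp
        then show ?thesis
          using False f supp_carrier[OF f] monom_mult_coeff_zero[of \<one> "\<one>\<^bsub>M\<^esub>" f z]
          by (auto simp: monoid_ring_simps)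
      qed
    qed
  qed (use mult_closed mult_assoc mult_comm in blast)+
  show "(f \<oplus>\<^bsub>RM\<^esub> g) \<otimes>\<^bsub>RM\<^esub> h = f \<otimes>\<^bsub>RM\<^esub> h \<oplus>\<^bsub>RM\<^esub> g \<otimes>\<^bsub>RM\<^esub> h"
    if f: "f \<in> carrier RM" and g: "g \<in> carrier RM" and h: "h \<in> carrier RM" for f g h
  proof
    fix z
    \<comment> \<open>One index set for \<open>f\<close>, \<open>g\<close> and their sum, so that
      the expansions can be added term by term.\<close>
    let ?X = "supp f \<union> supp g"
    interpret A: abelian_group RM by fact
    note fg = A.a_closed[OF f g]
    have sub: "supp (f \<oplus>\<^bsub>RM\<^esub> g) \<subseteq> ?X" by (auto simp: supp_def monoid_ring_simps)
    have cl [simp]: "f x \<in> carrier R" "g x \<in> carrier R" "h x \<in> carrier R" for x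
      using f g h by auto
    let ?s = "\<lambda>k. \<Oplus>x\<in>?X. \<Oplus>y\<in>supp h. if x \<otimes>\<^bsub>M\<^esub> y = z then k x \<otimes> h y else \<zero>"
    have "((f \<oplus>\<^bsub>RM\<^esub> g) \<otimes>\<^bsub>RM\<^esub> h) z = ?s (f \<oplus>\<^bsub>RM\<^esub> g)"
      using f g h fg sub by (intro mult_coeff) auto
    also have "\<dots> = (\<Oplus>x\<in>?X. \<Oplus>y\<in>supp h. (if x \<otimes>\<^bsub>M\<^esub> y = z then f x \<otimes> h y else \<zero>)
        \<oplus> (if x \<otimes>\<^bsub>M\<^esub> y = z then g x \<otimes> h y else \<zero>))"
      by (intro finsum_cong' refl) (auto simp: monoid_ring_simps l_distr intro!: finsum_closed)
    also have "\<dots> = (\<Oplus>x\<in>?X. (\<Oplus>y\<in>supp h. if x \<otimes>\<^bsub>M\<^esub> y = z then f x \<otimes> h y else \<zero>)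
        \<oplus> (\<Oplus>y\<in>supp h. if x \<otimes>\<^bsub>M\<^esub> y = z then g x \<otimes> h y else \<zero>))"
      by (intro finsum_cong' refl finsum_addf) (auto intro!: finsum_closed)
    also have "\<dots> = ?s f \<oplus> ?s g"
      by (intro finsum_addf) (auto intro!: finsum_closed)
    also have "?s f = (f \<otimes>\<^bsub>RM\<^esub> h) z"
      using f g h by (intro mult_coeff[symmetric]) auto
    also have "?s g = (g \<otimes>\<^bsub>RM\<^esub> h) z"
      using f g h by (intro mult_coeff[symmetric]) auto
    finally show "((f \<oplus>\<^bsub>RM\<^esub> g) \<otimes>\<^bsub>RM\<^esub> h) z = (f \<otimes>\<^bsub>RM\<^esub> h \<oplus>\<^bsub>RM\<^esub> g \<otimes>\<^bsub>RM\<^esub> h) z"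
      by (simp add: monoid_ring_simps(3)[of "f \<otimes>\<^bsub>RM\<^esub> h"])
  qed
qed

sublocale RM: cring RM by (rule cring_monoid_ring)

section \<open>Nilpotency and primes seen through coefficients\<close>

lemma monom_pow:
  assumes "c \<in> carrier R" "m \<in> carrier M"
  shows "monom c m [^]\<^bsub>RM\<^esub> (n::nat) = monom (c [^] n) (m [^]\<^bsub>M\<^esub> n)"
  using assms by (induction n) (auto simp: monoid_ring_simps monom_mult_monom)

text \<open>An element is the finite sum of its monomials; the induction on the support splits off
  one monomial at a time.\<close>

lemma mem_ideal_if_monoms_mem:
  assumes "ideal Q RM" and f: "f \<in> carrier RM" and monoms: "\<And>m. m \<in> supp f \<Longrightarrow> monom (f m) m \<in> Q"
  shows "f \<in> Q"
proof -
  interpret Q: ideal Q RM by fact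
  have "h \<in> Q" if "supp h = S" "finite S" "h \<in> carrier RM" "\<And>m. m \<in> S \<Longrightarrow> monom (h m) m \<in> Q" for S h
    using that(2,1,3,4)
  proof (induction S arbitrary: h)
    case empty
    then have "h = \<zero>\<^bsub>RM\<^esub>" by (auto simp: supp_def monoid_ring_simps)
    then show ?case by simp
  next
    case (insert s S)
    let ?h = "h(s := \<zero>)"
    have supp: "supp ?h = S" using insert.hyps insert.prems(1) by (auto simp: supp_def)
    have "S \<subseteq> carrier M" using supp_carrier[OF insert.prems(2)] insert.prems(1) by blast
    then have h: "?h \<in> carrier RM"
      using insert.prems(2) insert.hyps(1) supp by (intro mem_carrierI[of _ S]) auto
    have "monom (?h m) m \<in> Q" if "m \<in> S" for m
      using that insert.prems(3)[of m] insert.hyps by auto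
    then have "?h \<in> Q" using insert.IH[OF supp h] by blast
    then have "monom (h s) s \<oplus>\<^bsub>RM\<^esub> ?h \<in> Q" using insert.prems(3) by auto
    also have "monom (h s) s \<oplus>\<^bsub>RM\<^esub> ?h = h"
      using insert.prems(2) by (auto simp: monoid_ring_simps monom_def)
    finally show ?case .
  qed
  then show ?thesis using f monoms by auto
qed

text \<open>A monomial with nilpotent coefficient is nilpotent, hence lies in every prime ideal
  \<open>Q\<close> of the monoid ring. So does \<open>f\<close>, being a sum of such
  monomials.\<close>

lemma nilradical_if_coeffs_nilradical:
  assumes f: "f \<in> carrier RM" and nil: "\<And>m. f m \<in> nilradical R"
  shows "f \<in> nilradical RM"
  unfolding RM.nilradical_eq_Inter
proof (intro CollectI conjI allI impI)
  fix Q assume Q: "primeideal Q RM"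
  show "f \<in> Q"
  proof (rule mem_ideal_if_monoms_mem[OF primeideal.axioms(1)[OF Q] f])
    fix m assume "m \<in> supp f"
    then have m: "m \<in> carrier M" using supp_carrier[OF f] by auto
    obtain n :: nat where "f m [^] n = \<zero>" using nil by (auto simp: nilradical_def)
    then have "monom (f m) m [^]\<^bsub>RM\<^esub> n = \<zero>\<^bsub>RM\<^esub>"
      using f m by (simp add: monom_pow) (simp add: monom_def monoid_ring_simps)
    then have "monom (f m) m \<in> nilradical RM"
      using f m monom_closed by (auto simp: nilradical_def)
    then show "monom (f m) m \<in> Q" using RM.nilradical_subset_primeideal[OF Q] by blast
  qed
qed (fact f)

text \<open>By uniqueness every other pair contributing to this coefficient has a factor in
  \<open>P\<close>. Modulo \<open>P\<close> the coefficient is therefore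
  \<open>f a \<otimes> g b\<close>, which primality keeps outside \<open>P\<close>.\<close>

lemma mult_coeff_notin_prime:
  assumes "primeideal P R" and f: "f \<in> carrier RM" and g: "g \<in> carrier RM"
    and a: "f a \<notin> P" and b: "g b \<notin> P"
    and unique: "\<And>x y. \<lbrakk>f x \<notin> P; g y \<notin> P; x \<otimes>\<^bsub>M\<^esub> y = a \<otimes>\<^bsub>M\<^esub> b\<rbrakk> \<Longrightarrow> x = a \<and> y = b"
  shows "(f \<otimes>\<^bsub>RM\<^esub> g) (a \<otimes>\<^bsub>M\<^esub> b) \<notin> P"
proof
  interpret P: primeideal P R by fact
  define S where "S = {(x, y). f x \<noteq> \<zero> \<and> g y \<noteq> \<zero> \<and> x \<otimes>\<^bsub>M\<^esub> y = a \<otimes>\<^bsub>M\<^esub> b}"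
  define r where "r = (\<Oplus>p\<in>S - {(a, b)}. f (fst p) \<otimes> g (snd p))"
  have cl: "f x \<in> carrier R" "g x \<in> carrier R" for x using f g by auto
  have "finite S" unfolding S_def by (rule finite_mult_support[OF f g])
  have "f a \<noteq> \<zero>" "g b \<noteq> \<zero>" using a b P.zero_closed by metis+
  then have "(a, b) \<in> S" by (simp add: S_def)
  have "f (fst p) \<otimes> g (snd p) \<in> P" if "p \<in> S - {(a, b)}" for p
  proof -
    obtain x y where xy: "p = (x, y)" by (cases p)
    then have "x \<otimes>\<^bsub>M\<^esub> y = a \<otimes>\<^bsub>M\<^esub> b" "x \<noteq> a \<or> y \<noteq> b"
      using that by (simp_all add: S_def)
    then have "f x \<in> P \<or> g y \<in> P" using unique[of x y] by blast
    then show ?thesis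
      unfolding xy fst_conv snd_conv
      using P.I_r_closed[of "f x" "g y"] P.I_l_closed[of "g y" "f x"] cl by metis
  qed
  then have rest: "r \<in> P" unfolding r_def by (rule P.finsum_mem)
  have "(f \<otimes>\<^bsub>RM\<^esub> g) (a \<otimes>\<^bsub>M\<^esub> b) = (\<Oplus>p\<in>S. f (fst p) \<otimes> g (snd p))"
    unfolding monoid_ring_def monoid.simps S_def ..
  also have "\<dots> = (\<Oplus>p\<in>insert (a, b) (S - {(a, b)}). f (fst p) \<otimes> g (snd p))"
    by (simp only: insert_Diff[OF \<open>(a, b) \<in> S\<close>])
  also have "\<dots> = f a \<otimes> g b \<oplus> r"
    unfolding r_def using \<open>finite S\<close> cl by (subst finsum_insert) auto
  finally have eq: "(f \<otimes>\<^bsub>RM\<^esub> g) (a \<otimes>\<^bsub>M\<^esub> b) = f a \<otimes> g b \<oplus> r" .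
  assume "(f \<otimes>\<^bsub>RM\<^esub> g) (a \<otimes>\<^bsub>M\<^esub> b) \<in> P"
  then have "f a \<otimes> g b \<oplus> r \<oplus> \<ominus> r \<in> P"
    unfolding eq by (rule P.a_closed[OF _ P.a_inv_closed[OF rest]])
  also have "f a \<otimes> g b \<oplus> r \<oplus> \<ominus> r = f a \<otimes> g b"
    using cl P.Icarr[OF rest] by (simp add: a_assoc r_neg)
  finally show False using P.I_prime[OF cl(1) cl(2), of a b] a b by metis
qed

end

section \<open>Totally ordered cancellative monoids\<close>

locale totally_ordered_monoid_cancel = totally_ordered_monoid M less + comm_monoid_cancel M
  for M :: "('m, 'c) monoid_scheme" (structure) and less :: "'m \<Rightarrow> 'm \<Rightarrow> bool" (infix \<open>\<sqsubset>\<close> 50)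
begin

text \<open>Cancellation rules out the equality that \<open>mult_mono\<close> permits.\<close>

lemma mult_strict_mono:
  assumes "a \<in> carrier M" "b \<in> carrier M" "x \<in> carrier M" "a \<sqsubset> b"
  shows "a \<otimes> x \<sqsubset> b \<otimes> x"
  using mult_mono[OF assms] r_cancel[of a x b] assms less_irrefl by (auto simp: irreflp_on_def)

text \<open>Through this duality each fact about greatest elements also serves for least
  ones.\<close>

lemma totally_ordered_monoid_cancel_converse: "totally_ordered_monoid_cancel M (\<lambda>x y. y \<sqsubset> x)"
proof unfold_locales
  show "irreflp_on (carrier M) (\<lambda>x y. y \<sqsubset> x)" using less_irrefl by (auto simp: irreflp_on_def)
  show "transp_on (carrier M) (\<lambda>x y. y \<sqsubset> x)" using less_trans unfolding transp_on_def by blast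
  show "totalp_on (carrier M) (\<lambda>x y. y \<sqsubset> x)" using less_total unfolding totalp_on_def by blast
qed (use mult_strict_mono in blast)

lemma exists_greatest:
  assumes F: "finite F" "F \<noteq> {}" "F \<subseteq> carrier M"
  shows "\<exists>a\<in>F. \<forall>x\<in>F. x \<noteq> a \<longrightarrow> x \<sqsubset> a"
proof -
  have "transp_on F (\<sqsubset>)" using less_trans F(3) by (rule transp_on_subset)
  moreover have "irreflp_on F (\<sqsubset>)" using less_irrefl F(3) by (rule irreflp_on_subset)
  ultimately have "asymp_on F (\<sqsubset>)"
    unfolding asymp_on_def irreflp_on_def transp_on_def by blast
  then have "\<exists>a\<in>F. \<forall>x\<in>F. x \<noteq> a \<longrightarrow> \<not> a \<sqsubset> x"
    using Finite_Set.bex_max_element[OF F(1) _ \<open>transp_on F (\<sqsubset>)\<close> F(2)] by blast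
  then show ?thesis using less_total F(3) unfolding totalp_on_def by blast
qed

text \<open>If \<open>x\<close> were strictly below \<open>a\<close>, then
  \<open>x \<otimes> y\<close> would be strictly below \<open>a \<otimes> y\<close>, which is at
  most \<open>a \<otimes> b\<close>. Hence \<open>x = a\<close>, and cancelling \<open>a\<close>
  gives \<open>y = b\<close>.\<close>

lemma greatest_mult_unique:
  assumes ab: "a \<in> carrier M" "b \<in> carrier M" and xy: "x \<in> carrier M" "y \<in> carrier M"
    and le: "x \<noteq> a \<Longrightarrow> x \<sqsubset> a" "y \<noteq> b \<Longrightarrow> y \<sqsubset> b" and eq: "x \<otimes> y = a \<otimes> b"
  shows "x = a \<and> y = b"
proof -
  have "x = a"
  proof (rule ccontr)
    assume "x \<noteq> a"
    then have 1: "x \<otimes> y \<sqsubset> a \<otimes> y" using le ab xy by (simp add: mult_strict_mono)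
    have "y \<noteq> b \<Longrightarrow> a \<otimes> y \<sqsubset> a \<otimes> b"
      using mult_strict_mono[of y b a] le ab xy by (simp add: m_comm)
    with 1 have "x \<otimes> y \<sqsubset> a \<otimes> b"
      using transp_onD[OF less_trans _ _ _ 1, of "a \<otimes> b"] ab xy by (cases "y = b") auto
    then show False using eq less_irrefl ab by (auto simp: irreflp_on_def)
  qed
  with eq ab xy show ?thesis using l_cancel by auto
qed

lemma less_one_if_finite:
  assumes fin: "finite (carrier M)" and x: "x \<in> carrier M" "x \<noteq> \<one>"
  shows "x \<sqsubset> \<one>"
proof -
  obtain e where e: "e \<in> carrier M" "\<And>y. \<lbrakk>y \<in> carrier M; y \<noteq> e\<rbrakk> \<Longrightarrow> y \<sqsubset> e"
    using exists_greatest[OF fin] one_closed by blast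
  \<comment> \<open>Both \<open>\<one>\<close> and \<open>e \<otimes> e\<close> are at most the
    greatest element \<open>e\<close>, and their product equals \<open>e \<otimes> e\<close>;
    uniqueness then identifies \<open>\<one>\<close> with \<open>e\<close>.\<close>
  have "\<one> = e"
    using greatest_mult_unique[of e e \<one> "e \<otimes> e"] e by auto
  then show ?thesis using e(2)[OF x(1)] x(2) by simp
qed

text \<open>In a finite carrier \<open>\<one>\<close> would be greatest both for the order and for
  its converse, leaving no room for another element.\<close>

lemma infinite_carrier:
  assumes "a \<in> carrier M" "b \<in> carrier M" "a \<noteq> b"
  shows "infinite (carrier M)"
proof
  assume fin: "finite (carrier M)"
  interpret C: totally_ordered_monoid_cancel M "\<lambda>x y. y \<sqsubset> x"
    by (rule totally_ordered_monoid_cancel_converse)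
  obtain x where x: "x \<in> carrier M" "x \<noteq> \<one>" using assms by metis
  have "x \<sqsubset> \<one>" "\<one> \<sqsubset> x"
    using less_one_if_finite[OF fin x] C.less_one_if_finite[OF fin x] by auto
  then show False using less_trans less_irrefl x
    unfolding transp_on_def irreflp_on_def by (metis one_closed)
qed

text \<open>By cancellation each \<open>s\<close> excludes at most one \<open>m\<close>, so a finite
  \<open>S\<close> excludes only finitely many.\<close>

lemma exists_translate_avoiding_one:
  assumes inf: "infinite (carrier M)" and S: "finite S" "S \<subseteq> carrier M"
  shows "\<exists>m\<in>carrier M. \<forall>s\<in>S. m \<otimes> s \<noteq> \<one>"
proof -
  have "finite {m \<in> carrier M. m \<otimes> s = \<one>}" if "s \<in> S" for s
  proof (cases "\<exists>m\<in>carrier M. m \<otimes> s = \<one>")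
    case True
    then obtain m where m: "m \<in> carrier M" "m \<otimes> s = \<one>" by blast
    then have "{m \<in> carrier M. m \<otimes> s = \<one>} \<subseteq> {m}"
      using that S(2) r_cancel[of _ s m] by auto
    then show ?thesis using finite_subset by blast
  next
    case False
    then have "{m \<in> carrier M. m \<otimes> s = \<one>} = {}" by auto
    then show ?thesis by (metis finite.emptyI)
  qed
  then have "finite (\<Union>s\<in>S. {m \<in> carrier M. m \<otimes> s = \<one>})" using S(1) by blast
  with inf have "\<not> carrier M \<subseteq> (\<Union>s\<in>S. {m \<in> carrier M. m \<otimes> s = \<one>})"
    using finite_subset by blast
  then show ?thesis by blast
qed

end

section \<open>Units of the monoid ring modulo a prime\<close>

locale cring_totally_ordered_monoid = cring_comm_monoid R M + M: totally_ordered_monoid_cancel M less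
  for R :: "('a, 'b) ring_scheme" (structure) and M :: "('m, 'c) monoid_scheme"
    and less :: "'m \<Rightarrow> 'm \<Rightarrow> bool"
begin

text \<open>Let \<open>F\<close> and \<open>G\<close> be the supports of \<open>f\<close> and
  \<open>g\<close> modulo \<open>P\<close>. Their greatest elements multiply to the neutral element,
  and so do their least elements. Uniqueness of the top factorization makes the greatest and least
  elements of \<open>F\<close> coincide.\<close>

lemma unit_coeff_notin_prime_unique:
  assumes "primeideal P R" and f: "f \<in> carrier RM" and g: "g \<in> carrier RM"
    and fg: "f \<otimes>\<^bsub>RM\<^esub> g = \<one>\<^bsub>RM\<^esub>" and p: "f p \<notin> P" and q: "f q \<notin> P"
  shows "p = q"
proof -
  interpret P: primeideal P R by fact
  define F where "F = {m. f m \<notin> P}"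
  define G where "G = {m. g m \<notin> P}"
  have "F \<subseteq> supp f" "G \<subseteq> supp g"
    using P.zero_closed by (auto simp: F_def G_def supp_def)
  then have F: "finite F" "F \<subseteq> carrier M" and G: "finite G" "G \<subseteq> carrier M"
    using f g supp_carrier finite_subset[OF _ finite_supp] by blast+
  have "F \<noteq> {}" using p by (auto simp: F_def)
  \<comment> \<open>If all coefficients of \<open>g\<close> were in \<open>P\<close>, the
    coefficient \<open>\<one>\<close> of the product at the neutral element would be as
    well.\<close>
  have "G \<noteq> {}"
  proof
    assume "G = {}"
    then have gP: "g m \<in> P" for m by (auto simp: G_def)
    have "(f \<otimes>\<^bsub>RM\<^esub> g) \<one>\<^bsub>M\<^esub> \<in> P"
      unfolding monoid_ring_def monoid.simps using f gP
      by (intro P.finsum_mem) (auto simp: P.I_l_closed)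
    then have "\<one> \<in> P" by (simp add: fg monoid_ring_simps monom_def)
    then show False using P.one_imp_carrier P.I_notcarr by auto
  qed
  \<comment> \<open>Stated for an arbitrary order on \<open>M\<close>, to be applied to the given
    order and to its converse.\<close>
  have extreme: "\<exists>a\<in>F. \<exists>b\<in>G. a \<otimes>\<^bsub>M\<^esub> b = \<one>\<^bsub>M\<^esub> \<and> (\<forall>x\<in>F. x \<noteq> a \<longrightarrow> less x a) \<and>
      (\<forall>x\<in>F. \<forall>y\<in>G. x \<otimes>\<^bsub>M\<^esub> y = a \<otimes>\<^bsub>M\<^esub> b \<longrightarrow> x = a \<and> y = b)"
    if M: "totally_ordered_monoid_cancel M less" for less
  proof -
    interpret L: totally_ordered_monoid_cancel M less by fact
    obtain a where a: "a \<in> F" "\<And>x. \<lbrakk>x \<in> F; x \<noteq> a\<rbrakk> \<Longrightarrow> less x a"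
      using L.exists_greatest[OF F(1) \<open>F \<noteq> {}\<close> F(2)] by blast
    obtain b where b: "b \<in> G" "\<And>x. \<lbrakk>x \<in> G; x \<noteq> b\<rbrakk> \<Longrightarrow> less x b"
      using L.exists_greatest[OF G(1) \<open>G \<noteq> {}\<close> G(2)] by blast
    have unique: "x = a \<and> y = b" if "x \<in> F" "y \<in> G" "x \<otimes>\<^bsub>M\<^esub> y = a \<otimes>\<^bsub>M\<^esub> b" for x y
      by (rule L.greatest_mult_unique) (use that a b F(2) G(2) in auto)
    have "(f \<otimes>\<^bsub>RM\<^esub> g) (a \<otimes>\<^bsub>M\<^esub> b) \<notin> P"
      using a(1) b(1) unique
      by (intro mult_coeff_notin_prime[OF assms(1) f g]) (auto simp: F_def G_def)
    then have "a \<otimes>\<^bsub>M\<^esub> b = \<one>\<^bsub>M\<^esub>"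
      using P.zero_closed by (auto simp: fg monoid_ring_simps monom_def split: if_splits)
    then show ?thesis using a b unique by blast
  qed
  from extreme[OF M.totally_ordered_monoid_cancel_axioms]
  obtain a b where ab: "a \<in> F" "b \<in> G" "a \<otimes>\<^bsub>M\<^esub> b = \<one>\<^bsub>M\<^esub>" "\<And>x. \<lbrakk>x \<in> F; x \<noteq> a\<rbrakk> \<Longrightarrow> less x a"
    "\<And>x y. \<lbrakk>x \<in> F; y \<in> G; x \<otimes>\<^bsub>M\<^esub> y = a \<otimes>\<^bsub>M\<^esub> b\<rbrakk> \<Longrightarrow> x = a \<and> y = b" by blast
  from extreme[OF M.totally_ordered_monoid_cancel_converse]
  obtain a' b' where a'b': "a' \<in> F" "b' \<in> G" "a' \<otimes>\<^bsub>M\<^esub> b' = \<one>\<^bsub>M\<^esub>"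
    "\<And>x. \<lbrakk>x \<in> F; x \<noteq> a'\<rbrakk> \<Longrightarrow> less a' x" by blast
  have "a' = a" using ab a'b' by metis
  have "x = a" if "x \<in> F" for x
  proof (rule ccontr)
    assume "x \<noteq> a"
    then have "less x a" "less a x" using that ab(4) a'b'(4) \<open>a' = a\<close> by blast+
    then show False
      using M.less_trans M.less_irrefl that ab(1) F(2) unfolding transp_on_def irreflp_on_def by blast
  qed
  then show ?thesis using p q by (auto simp: F_def)
qed

lemma jacobson_radical_coeff_nilradical:
  assumes inf: "infinite (carrier M)" and x: "x \<in> jacobson_radical RM"
  shows "x s \<in> nilradical R"
proof -
  have xc: "x \<in> carrier RM" using x by (simp add: jacobson_radical_def)
  obtain m where m: "m \<in> carrier M" "\<And>s. s \<in> supp x \<Longrightarrow> m \<otimes>\<^bsub>M\<^esub> s \<noteq> \<one>\<^bsub>M\<^esub>"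
    using M.exists_translate_avoiding_one[OF inf finite_supp[OF xc] supp_carrier[OF xc]] by blast
  \<comment> \<open>The coefficient \<open>\<ominus> \<one>\<close> carries the sign, so that
    \<open>u\<close> is \<open>\<one>\<close> minus the translate of \<open>x\<close> by
    \<open>m\<close>.\<close>
  define y where "y = monom (\<ominus> \<one>) m \<otimes>\<^bsub>RM\<^esub> x"
  define u where "u = \<one>\<^bsub>RM\<^esub> \<oplus>\<^bsub>RM\<^esub> y"
  have mc: "monom (\<ominus> \<one>) m \<in> carrier RM" using m by (simp add: monom_closed)
  have yc: "y \<in> carrier RM" unfolding y_def using mc xc by simp
  then have uc: "u \<in> carrier RM" by (simp add: u_def)
  have "u \<in> Units RM"
  proof (rule RM.Units_if_in_no_maximalideal[OF uc])
    fix I assume max: "maximalideal I RM"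
    interpret I: maximalideal I RM by fact
    show "u \<notin> I"
    proof
      assume "u \<in> I"
      moreover have "y \<in> I"
        using x max mc by (auto simp: jacobson_radical_def y_def I.I_l_closed)
      ultimately have "u \<ominus>\<^bsub>RM\<^esub> y \<in> I" by (simp add: RM.minus_eq)
      also have "u \<ominus>\<^bsub>RM\<^esub> y = \<one>\<^bsub>RM\<^esub>"
        using yc by (simp add: u_def RM.minus_eq RM.a_assoc RM.r_neg)
      finally show False using I.one_imp_carrier I.I_notcarr by auto
    qed
  qed
  then obtain v where v: "v \<in> carrier RM" "u \<otimes>\<^bsub>RM\<^esub> v = \<one>\<^bsub>RM\<^esub>" by (auto simp: Units_def)
  \<comment> \<open>The choice of \<open>m\<close> keeps the translated support away from the
    neutral element.\<close>
  have u1: "u \<one>\<^bsub>M\<^esub> = \<one>"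
    using monom_mult_coeff_zero[of "\<ominus> \<one>" m x "\<one>\<^bsub>M\<^esub>"] m xc
    by (auto simp: u_def y_def monoid_ring_simps monom_def)
  have "x s \<in> P" if P: "primeideal P R" for P
  proof (cases "s \<in> supp x")
    case True
    interpret P: primeideal P R by fact
    have s: "s \<in> carrier M" using True supp_carrier[OF xc] by auto
    have "y (m \<otimes>\<^bsub>M\<^esub> s) = \<ominus> \<one> \<otimes> x s"
      unfolding y_def using m(1) s xc M.l_cancel by (intro monom_mult_coeff_translate) auto
    then have us: "u (m \<otimes>\<^bsub>M\<^esub> s) = \<ominus> x s"
      using m(2)[OF True] xc by (simp add: u_def monoid_ring_simps monom_def l_minus)
    have "u \<one>\<^bsub>M\<^esub> \<notin> P" using u1 P.one_imp_carrier P.I_notcarr by auto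
    then have "\<ominus> x s \<in> P"
      using unit_coeff_notin_prime_unique[OF P uc v, of "\<one>\<^bsub>M\<^esub>" "m \<otimes>\<^bsub>M\<^esub> s"] m(2)[OF True] us by metis
    then show ?thesis using P.a_inv_closed[of "\<ominus> x s"] xc by simp
  next
    case False
    then show ?thesis
      using additive_subgroup.zero_closed[OF ideal.axioms(1)[OF primeideal.axioms(1)[OF P]]]
      by (simp add: supp_def)
  qed
  then show ?thesis using xc by (simp add: nilradical_eq_Inter)
qed

end

theorem corollary7p19:
  fixes R :: "('a, 'b) ring_scheme"
    and M :: "('m, 'c) monoid_scheme"
    and less :: "'m \<Rightarrow> 'm \<Rightarrow> bool"
  assumes "cring R"
    and "totally_ordered_monoid M less"
    and "comm_monoid_cancel M"
    and "\<exists>a\<in>carrier M. \<exists>b\<in>carrier M. a \<noteq> b"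
  shows "quasi_jacobson (monoid_ring R M)"
proof -
  interpret cring R by fact
  interpret M: totally_ordered_monoid M less by fact
  interpret M: comm_monoid_cancel M by fact
  interpret cring_totally_ordered_monoid R M less by unfold_locales
  have "infinite (carrier M)" using assms(4) M.infinite_carrier by blast
  then have "jacobson_radical RM \<subseteq> nilradical RM"
    using nilradical_if_coeffs_nilradical jacobson_radical_coeff_nilradical
    by (auto simp: jacobson_radical_def)
  \<comment> \<open>The opposite inclusion holds in every commutative ring, because maximal ideals
    are prime.\<close>
  then show ?thesis
    using RM.nilradical_subset_jacobson_radical by (auto simp: quasi_jacobson_def)
qed

end
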